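(* For every $C>1$ there exists $c^*=c^*(C)>0$, independent of $n$, with the following property. Let $n$ be a positive integer and let $\mathcal{H}_1,\mathcal{H}_2\subset\mathbb{R}^2$ satisfy: (a) $n\le|\mathcal{H}_1|,|\mathcal{H}_2|\le Cn$; (b) $\mathcal{H}_2$ lies on a non-degenerate conic that contains no point of $\mathcal{H}_1$; (c) the number of straight lines $l$ for which there exist three distinct points $P_1,P_2,P_3\in l$ with $P_1\in\mathcal{H}_1$ and $P_2,P_3\in\mathcal{H}_2$ is at least $n^2$. Then some $c^*n$ points of $\mathcal{H}_1$ are collinear. *)

theory Defs
  imports "HOL-Analysis.Analysis"
begin

definition is_line :: "(real^2) set \<Rightarrow> bool" where
  "is_line l \<longleftrightarrow> affine l \<and> aff_dim l = 1"

text \<open>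
  A conic is the zero set of a quadratic polynomial
  \<open>a x\<^sup>2 + 2 b x y + c y\<^sup>2 + 2 d x + 2 e y + f\<close>, here written as \<open>v\<^sup>T A v\<close> with
  \<open>v = (x, y, 1)\<close> and \<open>A\<close> symmetric with rows \<open>(a, b, d)\<close>, \<open>(b, c, e)\<close>, \<open>(d, e, f)\<close>.
  It is non-degenerate iff \<open>det A \<noteq> 0\<close>; this forces \<open>(a, b, c) \<noteq> 0\<close>, so the polynomial
  really has degree 2. Non-emptiness excludes the conics without real points, such as
  \<open>x\<^sup>2 + y\<^sup>2 + 1 = 0\<close>; what remains are the ellipses, parabolas and hyperbolas.
\<close>

definition nondegenerate_conic :: "(real^2) set \<Rightarrow> bool" where
  "nondegenerate_conic S \<longleftrightarrow> S \<noteq> {} \<and>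
     (\<exists>A :: real^3^3. transpose A = A \<and> det A \<noteq> 0 \<and>
        S = {p. (vector [p $ 1, p $ 2, 1] :: real^3) \<bullet> (A *v vector [p $ 1, p $ 2, 1]) = 0})"

definition triple_lines :: "(real^2) set \<Rightarrow> (real^2) set \<Rightarrow> (real^2) set set" where
  "triple_lines H1 H2 = {l. is_line l \<and>
     (\<exists>P1 P2 P3. P1 \<noteq> P2 \<and> P1 \<noteq> P3 \<and> P2 \<noteq> P3 \<and> P1 \<in> l \<and> P2 \<in> l \<and> P3 \<in> l \<and>
        P1 \<in> H1 \<and> P2 \<in> H2 \<and> P3 \<in> H2)}"

end

theory Submission
  imports Defs
begin

text \<open>
  Parametrise the conic rationally by \<open>t\<close>. A point \<open>P\<close> off the conic exchanges the two points of
  the conic on each line through \<open>P\<close>, and in the parameter \<open>t\<close> this is a Moebius involution given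
  by a trace-free matrix that depends linearly on the homogeneous coordinates of \<open>P\<close>. The
  hypothesis on lines says that these involutions send many elements of the parameter set \<open>X\<close> of
  \<open>\<H>\<^sub>2\<close> into \<open>X\<close>. By Cauchy-Schwarz, for a positive proportion of the pairs \<open>(P, Q)\<close> the composed
  map has a graph with at least a constant times \<open>n\<close> points in \<open>X \<times> X\<close>. But there are only
  \<open>O(n)\<close> such Moebius graphs: cutting \<open>X\<close> into blocks of bounded size, a graph has two monotone
  branches and so meets few of the resulting cells; hence it contains \<open>\<Omega>(n)\<close> triples of points
  within single cells, while there are only \<open>O(n\<^sup>2)\<close> such triples and each lies on at most one graph.
  So one composed map arises from at least a constant times \<open>n\<close> pairs \<open>(P, Q)\<close>. The points \<open>P\<close>
  of these pairs are distinct, and they all lie on the axis of that map.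
\<close>

subsection \<open>Moebius graphs in a grid\<close>

text \<open>The graph of the Moebius map with matrix rows \<open>(a, b)\<close>,
  \<open>(c, d)\<close>, denominator cleared. If the determinant is nonzero, no point lies over the
  pole.\<close>

definition mobius_graph :: "real \<Rightarrow> real \<Rightarrow> real \<Rightarrow> real \<Rightarrow> (real \<times> real) set" where
  "mobius_graph a b c d = {(x, z). c * x * z + d * z = a * x + b}"

lemma mobius_graph_denominator:
  assumes "a * d \<noteq> b * c" "(x, z) \<in> mobius_graph a b c d"
  shows "c * x + d \<noteq> 0"
proof
  assume 0: "c * x + d = 0"
  have "a * x + b = (c * x + d) * z"
    using assms(2) by (simp add: mobius_graph_def algebra_simps)
  then have 1: "a * x + b = 0" using 0 by simp
  have "a * d - b * c = a * (c * x + d) - c * (a * x + b)" by algebra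
  then show False using 0 1 assms(1) by simp
qed

lemma mobius_graph_functional:
  assumes "a * d \<noteq> b * c" "(x, z) \<in> mobius_graph a b c d" "(x, z') \<in> mobius_graph a b c d"
  shows "z = z'"
proof -
  have "(c * x + d) * (z - z') = 0"
    using assms(2,3) by (simp add: mobius_graph_def algebra_simps)
  then show ?thesis using mobius_graph_denominator[OF assms(1,2)] by simp
qed

text \<open>The difference quotient is the determinant divided by the two denominators, so its sign
  is constant on each side of the pole. This is what makes the branches monotone.\<close>

lemma mobius_graph_difference:
  assumes "(x, z) \<in> mobius_graph a b c d" "(x', z') \<in> mobius_graph a b c d"
  shows "(z - z') * ((c * x + d) * (c * x' + d)) = (a * d - b * c) * (x - x')"
proof -
  have "c * x * z + d * z = a * x + b" "c * x' * z' + d * z' = a * x' + b"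
    using assms by (simp_all add: mobius_graph_def)
  then show ?thesis by algebra
qed

lemma quadratic_three_roots:
  fixes p q r x y z :: real
  assumes "p * x\<^sup>2 + q * x + r = 0" "p * y\<^sup>2 + q * y + r = 0" "p * z\<^sup>2 + q * z + r = 0"
    and "x \<noteq> y" "y \<noteq> z" "x \<noteq> z"
  shows "p = 0 \<and> q = 0 \<and> r = 0"
proof -
  have "(x - y) * (p * (x + y) + q) = 0" "(x - z) * (p * (x + z) + q) = 0"
    using assms(1-3) by algebra+
  then have *: "p * (x + y) + q = 0" "p * (x + z) + q = 0" using assms(4-6) by auto
  then have "p * (y - z) = 0" by algebra
  then have "p = 0" using assms(5) by simp
  then show ?thesis using * assms(1) by auto
qed

text \<open>Eliminating the second coordinate leaves a quadratic that vanishes at the first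
  coordinates of all common points; three distinct roots force its coefficients to be zero.\<close>

lemma mobius_graph_coefficients:
  assumes det: "a * d \<noteq> b * c" "a' * d' \<noteq> b' * c'"
    and sub: "{p, q, r} \<subseteq> mobius_graph a b c d \<inter> mobius_graph a' b' c' d'"
    and ne: "p \<noteq> q" "q \<noteq> r" "p \<noteq> r"
  shows "\<exists>k. a' = k * a \<and> b' = k * b \<and> c' = k * c \<and> d' = k * d"
proof -
  have quad: "(a * c' - a' * c) * (fst t)\<^sup>2 + (a * d' + b * c' - a' * d - b' * c) * fst t
      + (b * d' - b' * d) = 0" if "t \<in> {p, q, r}" for t
  proof -
    have "c * fst t * snd t + d * snd t = a * fst t + b"
      "c' * fst t * snd t + d' * snd t = a' * fst t + b'"
      using that sub by (auto simp: mobius_graph_def)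
    then show ?thesis by algebra
  qed
  have "fst s \<noteq> fst t" if "s \<in> {p, q, r}" "t \<in> {p, q, r}" "s \<noteq> t" for s t
    using mobius_graph_functional[OF det(1), of "fst s" "snd s" "snd t"] that sub
    by (metis Int_iff prod.collapse subsetD)
  then have "fst p \<noteq> fst q" "fst q \<noteq> fst r" "fst p \<noteq> fst r" using ne by auto
  then have eqs: "a * c' - a' * c = 0" "a * d' + b * c' - a' * d - b' * c = 0" "b * d' - b' * d = 0"
    using quadratic_three_roots[OF quad quad quad, of p q r] by auto
  \<comment> \<open>For the two matrices M and M', the equations \<open>eqs\<close> say adj(M') M =
    m I. Hence m M' = det(M') M and m^2 = det(M) det(M'), which is nonzero.\<close>
  define m where "m = a * d' - b' * c"
  have m: "m * a' = (a' * d' - b' * c') * a" "m * b' = (a' * d' - b' * c') * b"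
    "m * c' = (a' * d' - b' * c') * c" "m * d' = (a' * d' - b' * c') * d"
    unfolding m_def using eqs by algebra+
  have "m * m = (a * d - b * c) * (a' * d' - b' * c')"
    unfolding m_def using eqs by algebra
  then have "m \<noteq> 0" using det by auto
  then have "a' = (a' * d' - b' * c') / m * a" "b' = (a' * d' - b' * c') / m * b"
    "c' = (a' * d' - b' * c') / m * c" "d' = (a' * d' - b' * c') / m * d"
    using m by (simp_all add: field_simps)
  then show ?thesis by blast
qed

definition monotone_either :: "(real \<times> real) set \<Rightarrow> bool" where
  "monotone_either G \<longleftrightarrow>
     (\<forall>p\<in>G. \<forall>q\<in>G. fst p \<le> fst q \<longrightarrow> snd p \<le> snd q) \<or>
     (\<forall>p\<in>G. \<forall>q\<in>G. fst p \<le> fst q \<longrightarrow> snd q \<le> snd p)"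

lemma mobius_graph_branch_monotone:
  assumes det: "a * d \<noteq> b * c" and G: "G \<subseteq> mobius_graph a b c d"
    and same: "\<And>p q. p \<in> G \<Longrightarrow> q \<in> G \<Longrightarrow> (c * fst p + d) * (c * fst q + d) > 0"
  shows "monotone_either G"
proof -
  have diff: "(snd q - snd p) * ((c * fst q + d) * (c * fst p + d)) = (a * d - b * c) * (fst q - fst p)"
    if "p \<in> G" "q \<in> G" for p q
    using mobius_graph_difference[of "fst q" "snd q" a b c d "fst p" "snd p"] that G by auto
  show ?thesis
  proof (cases "a * d > b * c")
    case True
    have "snd p \<le> snd q" if "p \<in> G" "q \<in> G" "fst p \<le> fst q" for p q
    proof -
      have "(snd q - snd p) * ((c * fst q + d) * (c * fst p + d)) \<ge> 0"
        unfolding diff[OF that(1,2)] using True that(3) by simp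
      then show ?thesis using same[OF that(2,1)] by (auto simp: zero_le_mult_iff zero_less_mult_iff)
    qed
    then show ?thesis by (auto simp: monotone_either_def)
  next
    case False
    have "snd q \<le> snd p" if "p \<in> G" "q \<in> G" "fst p \<le> fst q" for p q
    proof -
      have "(snd q - snd p) * ((c * fst q + d) * (c * fst p + d)) \<le> 0"
        unfolding diff[OF that(1,2)] using False that(3) by (simp add: mult_nonpos_nonneg)
      then show ?thesis using same[OF that(2,1)] by (auto simp: mult_le_0_iff zero_less_mult_iff)
    qed
    then show ?thesis by (auto simp: monotone_either_def)
  qed
qed

lemma mobius_graph_two_branches:
  assumes det: "a * d \<noteq> b * c" and G: "G \<subseteq> mobius_graph a b c d"
  shows "\<exists>G1 G2. G = G1 \<union> G2 \<and> monotone_either G1 \<and> monotone_either G2"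
proof (intro exI conjI)
  let ?G1 = "{p \<in> G. c * fst p + d > 0}" and ?G2 = "{p \<in> G. c * fst p + d < 0}"
  have "c * fst p + d \<noteq> 0" if "p \<in> G" for p
    using mobius_graph_denominator[OF det, of "fst p" "snd p"] that G by auto
  then show "G = ?G1 \<union> ?G2" by (auto simp: not_less order.order_iff_strict)
  show "monotone_either ?G1"
    by (rule mobius_graph_branch_monotone[OF det]) (use G in auto)
  show "monotone_either ?G2"
    by (rule mobius_graph_branch_monotone[OF det]) (use G in \<open>auto intro: mult_neg_neg\<close>)
qed

section \<open>Counting curves by triples of points within grid cells\<close>

text \<open>The block number is the rank in \<open>X\<close> divided by \<open>s\<close>. The rank
  makes sense for every element of the type, so \<open>b\<close> is monotone outside
  \<open>X\<close> as well.\<close>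

lemma exists_monotone_blocks:
  fixes X :: "'a::linorder set"
  assumes "finite X" "s > 0"
  obtains b :: "'a \<Rightarrow> nat" where "\<And>x y. x \<le> y \<Longrightarrow> b x \<le> b y"
    "b ` X \<subseteq> {..<card X div s + 1}" "\<And>i. card {x \<in> X. b x = i} \<le> s"
proof
  define rank where "rank x = card {y \<in> X. y < x}" for x
  let ?b = "\<lambda>x. rank x div s"
  have rank_mono: "rank x \<le> rank y" if "x \<le> y" for x y
    unfolding rank_def using that assms(1) by (intro card_mono) auto
  then show "\<And>x y. x \<le> y \<Longrightarrow> ?b x \<le> ?b y" by (simp add: div_le_mono)
  have "rank x \<le> card X" for x
    unfolding rank_def using assms(1) by (intro card_mono) auto
  then show "?b ` X \<subseteq> {..<card X div s + 1}" by (auto simp: less_Suc_eq_le div_le_mono)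
  have rank_less: "rank x < rank y" if "x \<in> X" "x < y" for x y
    unfolding rank_def using that assms(1) by (intro psubset_card_mono) auto
  have inj: "inj_on rank X"
    by (rule inj_onI) (metis rank_less less_irrefl neqE)
  fix i
  have "rank ` {x \<in> X. ?b x = i} \<subseteq> {i * s..<i * s + s}"
  proof clarify
    fix x show "rank x \<in> {rank x div s * s..<rank x div s * s + s}"
      using assms(2) div_mult_mod_eq[of "rank x" s] mod_less_divisor[of s "rank x"]
      by (metis add_less_cancel_left atLeastLessThan_iff le_add1)
  qed
  then have "card (rank ` {x \<in> X. ?b x = i}) \<le> card {i * s..<i * s + s}"
    by (intro card_mono) auto
  then show "card {x \<in> X. ?b x = i} \<le> s"
    using card_image[OF inj_on_subset[OF inj, of "{x \<in> X. ?b x = i}"]] by auto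
qed

text \<open>The cells met form a chain, so one index tells them apart: \<open>i + j\<close> if it
  ascends, \<open>i + (t - j)\<close> if it descends. Both stay below \<open>2 * t\<close>, and as
  \<open>j < t\<close> the subtraction is never truncated.\<close>

lemma card_cells_monotone:
  fixes b :: "real \<Rightarrow> nat"
  assumes mono: "\<And>x y. x \<le> y \<Longrightarrow> b x \<le> b y" and bX: "b ` X \<subseteq> {..<t}"
    and G: "G \<subseteq> X \<times> X" "monotone_either G"
  shows "card (map_prod b b ` G) \<le> 2 * t"
proof -
  have lt: "b (fst p) < t" "b (snd p) < t" if "p \<in> G" for p
    using subsetD[OF G(1) that] bX by (auto simp: mem_Times_iff)
  have "\<exists>h :: nat \<times> nat \<Rightarrow> nat. inj_on h (map_prod b b ` G) \<and> h ` (map_prod b b ` G) \<subseteq> {..<2 * t}"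
    using G(2) unfolding monotone_either_def
  proof
    assume inc: "\<forall>p\<in>G. \<forall>q\<in>G. fst p \<le> fst q \<longrightarrow> snd p \<le> snd q"
    let ?h = "\<lambda>(i, j). i + j :: nat"
    have "inj_on ?h (map_prod b b ` G)"
    proof (rule inj_onI, clarsimp)
      fix x y x' y' assume p: "(x, y) \<in> G" "(x', y') \<in> G" and eq: "b x + b y = b x' + b y'"
      consider "x \<le> x'" "y \<le> y'" | "x' \<le> x" "y' \<le> y"
        using inc[rule_format, OF p] inc[rule_format, OF p(2,1)] by fastforce
      then show "b x = b x' \<and> b y = b y'"
        using mono[of x x'] mono[of y y'] mono[of x' x] mono[of y' y] eq by cases auto
    qed
    moreover have "?h ` (map_prod b b ` G) \<subseteq> {..<2 * t}" using lt by fastforce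
    ultimately show ?thesis by blast
  next
    assume dec: "\<forall>p\<in>G. \<forall>q\<in>G. fst p \<le> fst q \<longrightarrow> snd q \<le> snd p"
    let ?h = "\<lambda>(i, j). i + (t - j) :: nat"
    have "inj_on ?h (map_prod b b ` G)"
    proof (rule inj_onI, clarsimp)
      fix x y x' y' assume p: "(x, y) \<in> G" "(x', y') \<in> G"
        and eq: "b x + (t - b y) = b x' + (t - b y')"
      consider "x \<le> x'" "y' \<le> y" | "x' \<le> x" "y \<le> y'"
        using dec[rule_format, OF p] dec[rule_format, OF p(2,1)] by fastforce
      then show "b x = b x' \<and> b y = b y'"
        using mono[of x x'] mono[of y y'] mono[of x' x] mono[of y' y] eq lt[OF p(1)] lt[OF p(2)]
        by cases auto
    qed
    moreover have "?h ` (map_prod b b ` G) \<subseteq> {..<2 * t}" using lt by fastforce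
    ultimately show ?thesis by blast
  qed
  then show ?thesis using card_inj_on_le[of _ "map_prod b b ` G" "{..<2 * t}"] by auto
qed

text \<open>Converts the number of points in a cell into a number of triples, at a loss of at most 2
  per cell.\<close>

lemma le_choose_3: "p \<le> (p choose 3) + 2"
proof (induction p)
  case (Suc p)
  have "(Suc p choose 3) = (p choose 2) + (p choose 3)"
    by (simp add: numeral_3_eq_3 numeral_2_eq_2)
  moreover have "p \<ge> 2 \<Longrightarrow> (p choose 2) \<ge> 1"
    using zero_less_binomial[of 2 p] by linarith
  ultimately show ?case using Suc by (cases "p \<ge> 2") auto
qed simp

lemma choose_3_le: "(p choose 3) \<le> p ^ 3"
  by (cases "3 \<le> p") (auto simp: binomial_le_pow binomial_eq_0)

definition triples_in_fibers :: "('a \<Rightarrow> 'b) \<Rightarrow> 'a set \<Rightarrow> 'a set set" where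
  "triples_in_fibers f G = (\<Union>c\<in>f ` G. {\<tau>. \<tau> \<subseteq> {p \<in> G. f p = c} \<and> card \<tau> = 3})"

lemma card_triples_in_fibers:
  assumes "finite G"
  shows "card (triples_in_fibers f G) = (\<Sum>c\<in>f ` G. card {p \<in> G. f p = c} choose 3)"
proof -
  have "card (triples_in_fibers f G) =
      (\<Sum>c\<in>f ` G. card {\<tau>. \<tau> \<subseteq> {p \<in> G. f p = c} \<and> card \<tau> = 3})"
    unfolding triples_in_fibers_def
  proof (rule card_UN_disjoint)
    show "\<forall>c\<in>f ` G. \<forall>c'\<in>f ` G. c \<noteq> c' \<longrightarrow>
      {\<tau>. \<tau> \<subseteq> {p \<in> G. f p = c} \<and> card \<tau> = 3} \<inter> {\<tau>. \<tau> \<subseteq> {p \<in> G. f p = c'} \<and> card \<tau> = 3} = {}"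
    proof (intro ballI impI equals0I)
      fix c c' \<tau> assume "c \<noteq> c'"
        "\<tau> \<in> {\<tau>. \<tau> \<subseteq> {p \<in> G. f p = c} \<and> card \<tau> = 3} \<inter> {\<tau>. \<tau> \<subseteq> {p \<in> G. f p = c'} \<and> card \<tau> = 3}"
      then have "\<tau> = {}" "card \<tau> = 3" by auto
      then show False by simp
    qed
  qed (use assms in auto)
  then show ?thesis using assms by (simp add: n_subsets)
qed

lemma card_triples_in_fibers_ge:
  assumes "finite G" "card (f ` G) \<le> k"
  shows "card G \<le> card (triples_in_fibers f G) + 2 * k"
proof -
  have "card G = (\<Sum>c\<in>f ` G. card {p \<in> G. f p = c})"
    using sum.image_gen[OF assms(1), of "\<lambda>_. 1::nat" f] by simp
  also have "\<dots> \<le> (\<Sum>c\<in>f ` G. (card {p \<in> G. f p = c} choose 3) + 2)"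
    by (intro sum_mono le_choose_3)
  also have "\<dots> \<le> card (triples_in_fibers f G) + 2 * k"
    using assms by (simp add: card_triples_in_fibers sum.distrib del: add_2_eq_Suc')
  finally show ?thesis .
qed

lemma triples_in_fibers_mono: "G \<subseteq> H \<Longrightarrow> triples_in_fibers f G \<subseteq> triples_in_fibers f H"
  unfolding triples_in_fibers_def by blast

text \<open>Double counting of triples within cells. Two branches meet at most \<open>4 * t\<close>
  cells, so each curve holds at least \<open>m - 8 * t\<close> triples, and by \<open>meet\<close>
  no triple is shared. The grid has at most \<open>t^2\<close> cells of at most \<open>s^2\<close>
  points, each with at most \<open>s^6\<close> triples.\<close>

lemma card_rich_curves:
  fixes X :: "real set" and \<G> :: "(real \<times> real) set set"
  assumes X: "finite X" and s: "s > 0"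
    and sub: "\<And>G. G \<in> \<G> \<Longrightarrow> G \<subseteq> X \<times> X"
    and rich: "\<And>G. G \<in> \<G> \<Longrightarrow> m \<le> card G"
    and branches: "\<And>G. G \<in> \<G> \<Longrightarrow> \<exists>G1 G2. G = G1 \<union> G2 \<and> monotone_either G1 \<and> monotone_either G2"
    and meet: "\<And>G G' \<tau>. \<lbrakk>G \<in> \<G>; G' \<in> \<G>; \<tau> \<subseteq> G \<inter> G'; card \<tau> = 3\<rbrakk> \<Longrightarrow> G = G'"
    and t: "t = card X div s + 1"
  shows "card \<G> * (m - 8 * t) \<le> t\<^sup>2 * s ^ 6"
proof -
  obtain b :: "real \<Rightarrow> nat" where mono: "\<And>x y. x \<le> y \<Longrightarrow> b x \<le> b y"
    and bX: "b ` X \<subseteq> {..<t}" and fib: "\<And>i. card {x \<in> X. b x = i} \<le> s"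
    using exists_monotone_blocks[OF X s] unfolding t by metis
  let ?f = "map_prod b b"
  have XX: "finite (X \<times> X)" using X by simp
  have fin: "finite G" if "G \<in> \<G>" for G using finite_subset[OF sub[OF that] XX] .
  have fin\<G>: "finite \<G>" using sub XX by (intro finite_subset[of \<G> "Pow (X \<times> X)"]) auto
  have lower: "m - 8 * t \<le> card (triples_in_fibers ?f G)" if GG: "G \<in> \<G>" for G
  proof -
    obtain G1 G2 where G: "G = G1 \<union> G2" "monotone_either G1" "monotone_either G2"
      using branches[OF GG] by blast
    have "card (?f ` G) \<le> card (?f ` G1) + card (?f ` G2)"
      unfolding G(1) image_Un by (rule card_Un_le)
    also have "\<dots> \<le> 2 * t + 2 * t"
      using sub[OF GG] G by (intro add_mono card_cells_monotone[OF mono bX]) auto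
    finally have "card G \<le> card (triples_in_fibers ?f G) + 2 * (4 * t)"
      by (intro card_triples_in_fibers_ge fin GG) simp
    then show ?thesis using rich[OF GG] by linarith
  qed
  have fin_all: "finite (triples_in_fibers ?f (X \<times> X))"
    by (rule finite_subset[of _ "Pow (X \<times> X)"]) (use XX in \<open>auto simp: triples_in_fibers_def\<close>)
  have "card \<G> * (m - 8 * t) \<le> (\<Sum>G\<in>\<G>. card (triples_in_fibers ?f G))"
    using sum_mono[of \<G> "\<lambda>_. m - 8 * t", OF lower] by simp
  also have "\<dots> = card (\<Union>G\<in>\<G>. triples_in_fibers ?f G)"
  proof (rule card_UN_disjoint[symmetric], rule fin\<G>)
    show "\<forall>G\<in>\<G>. finite (triples_in_fibers ?f G)"
      using finite_subset[OF triples_in_fibers_mono[OF sub] fin_all] by blast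
    show "\<forall>G\<in>\<G>. \<forall>G'\<in>\<G>. G \<noteq> G' \<longrightarrow> triples_in_fibers ?f G \<inter> triples_in_fibers ?f G' = {}"
    proof (intro ballI impI equals0I)
      fix G G' \<tau> assume *: "G \<in> \<G>" "G' \<in> \<G>" "G \<noteq> G'"
        "\<tau> \<in> triples_in_fibers ?f G \<inter> triples_in_fibers ?f G'"
      then have "\<tau> \<subseteq> G \<inter> G'" "card \<tau> = 3" unfolding triples_in_fibers_def by blast+
      then show False using meet * by blast
    qed
  qed
  also have "\<dots> \<le> card (triples_in_fibers ?f (X \<times> X))"
    using triples_in_fibers_mono[OF sub] by (intro card_mono[OF fin_all]) blast
  also have "\<dots> = (\<Sum>c\<in>?f ` (X \<times> X). card {p \<in> X \<times> X. ?f p = c} choose 3)"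
    by (rule card_triples_in_fibers[OF XX])
  also have "\<dots> \<le> (\<Sum>c\<in>?f ` (X \<times> X). s ^ 6)"
  proof (rule sum_mono)
    fix c :: "nat \<times> nat"
    have "{p \<in> X \<times> X. ?f p = c} = {x \<in> X. b x = fst c} \<times> {x \<in> X. b x = snd c}" by auto
    then have "card {p \<in> X \<times> X. ?f p = c} \<le> s * s"
      using fib by (simp add: card_cartesian_product mult_le_mono)
    then have "card {p \<in> X \<times> X. ?f p = c} ^ 3 \<le> (s * s) ^ 3" by (rule power_mono) simp
    also have "(s * s) ^ 3 = s ^ 6" by (simp add: power_mult_distrib flip: power_add)
    finally show "card {p \<in> X \<times> X. ?f p = c} choose 3 \<le> s ^ 6"
      using choose_3_le le_trans by blast
  qed
  also have "\<dots> \<le> t\<^sup>2 * s ^ 6"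
  proof -
    have "?f ` (X \<times> X) \<subseteq> {..<t} \<times> {..<t}" using bX by auto
    then have "card (?f ` (X \<times> X)) \<le> card ({..<t} \<times> {..<t})" by (intro card_mono) auto
    then show ?thesis by (simp add: power2_eq_square)
  qed
  finally show ?thesis .
qed

subsection \<open>Compositions of involutions\<close>

text \<open>Cauchy-Schwarz for the degrees \<open>d y\<close>, the number of \<open>P\<close> with
  \<open>y\<close> in \<open>N P\<close>: their sum counts incidences, and the sum of their squares
  counts common elements over all ordered pairs.\<close>

lemma sum_card_squared_le_energy:
  fixes N :: "'a \<Rightarrow> 'b set"
  assumes "finite X" "\<And>P. P \<in> H \<Longrightarrow> N P \<subseteq> X"
  shows "(\<Sum>P\<in>H. real (card (N P)))\<^sup>2 \<le> real (card X) * (\<Sum>P\<in>H. \<Sum>Q\<in>H. real (card (N P \<inter> N Q)))"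
proof -
  have card_ind: "real (card (A \<inter> N P)) = (\<Sum>y\<in>X. of_bool (y \<in> A \<inter> N P))" if "P \<in> H" for A P
  proof -
    have "X \<inter> {y. y \<in> A \<inter> N P} = A \<inter> N P" using assms(2)[OF that] by blast
    then show ?thesis using assms(1) by (simp add: sum_of_bool_eq)
  qed
  define d where "d y = (\<Sum>P\<in>H. of_bool (y \<in> N P) :: real)" for y
  have "(\<Sum>P\<in>H. real (card (N P))) = (\<Sum>P\<in>H. \<Sum>y\<in>X. of_bool (y \<in> N P))"
    using card_ind[of _ UNIV] by simp
  also have "\<dots> = (\<Sum>y\<in>X. d y)" unfolding d_def by (rule sum.swap)
  finally have 1: "(\<Sum>P\<in>H. real (card (N P))) = (\<Sum>y\<in>X. d y)" .
  have "(\<Sum>P\<in>H. \<Sum>Q\<in>H. real (card (N P \<inter> N Q)))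
      = (\<Sum>P\<in>H. \<Sum>Q\<in>H. \<Sum>y\<in>X. of_bool (y \<in> N P) * of_bool (y \<in> N Q))"
    using card_ind by (simp add: of_bool_conj)
  also have "\<dots> = (\<Sum>P\<in>H. \<Sum>y\<in>X. \<Sum>Q\<in>H. of_bool (y \<in> N P) * of_bool (y \<in> N Q))"
    by (intro sum.cong refl sum.swap)
  also have "\<dots> = (\<Sum>y\<in>X. \<Sum>P\<in>H. \<Sum>Q\<in>H. of_bool (y \<in> N P) * of_bool (y \<in> N Q))"
    by (rule sum.swap)
  also have "\<dots> = (\<Sum>y\<in>X. (d y)\<^sup>2)"
    unfolding d_def power2_eq_square sum_product ..
  finally show ?thesis
    using 1 sum_squared_le_sum_of_squares[of d X] by (simp add: mult.commute)
qed

lemma pigeonhole_fiber: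
  assumes "finite R" "R \<noteq> {}"
  obtains y where "y \<in> f ` R" "card R \<le> card (f ` R) * card {x \<in> R. f x = y}"
proof -
  let ?F = "\<lambda>y. card {x \<in> R. f x = y}"
  have "Max (?F ` (f ` R)) \<in> ?F ` (f ` R)" using assms by (intro Max_in) auto
  then obtain y where y: "y \<in> f ` R" "?F y = Max (?F ` (f ` R))" by (metis (no_types, lifting) imageE)
  have "card R = (\<Sum>z\<in>f ` R. ?F z)"
    using sum.image_gen[OF assms(1), of "\<lambda>_. 1::nat" f] by simp
  also have "\<dots> \<le> card (f ` R) * ?F y"
    using sum_bounded_above[of "f ` R" ?F "?F y"] y(2) assms(1) by simp
  finally show ?thesis using that y(1) by blast
qed

section \<open>Algebra of trace-free matrices\<close>

text \<open>The relation \<open>y = (v x - u) / (w x - v)\<close> with the denominator cleared,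
  which makes the symmetry in \<open>x\<close> and \<open>y\<close> visible. The matrix has
  determinant \<open>u w - v^2\<close>.\<close>

definition involution_pair :: "real \<Rightarrow> real \<Rightarrow> real \<Rightarrow> real \<Rightarrow> real \<Rightarrow> bool" where
  "involution_pair u v w x y \<longleftrightarrow> w * x * y - v * (x + y) + u = 0"

lemma involution_pair_unique:
  assumes "u * w \<noteq> v\<^sup>2" "involution_pair u v w x y" "involution_pair u v w x y'"
  shows "y = y'"
proof -
  have "(w * x - v) * (y - y') = 0"
    using assms(2,3) unfolding involution_pair_def by algebra
  moreover have "w * x - v \<noteq> 0"
  proof
    assume 0: "w * x - v = 0"
    then have "v * x = u" using assms(2) unfolding involution_pair_def by algebra
    moreover have "w * x = v" using 0 by simp
    ultimately have "u * w = v\<^sup>2" by (metis mult.assoc mult.commute power2_eq_square)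
    then show False using assms(1) by simp
  qed
  ultimately show ?thesis by simp
qed

text \<open>
  The involution \<open>(u', v', w')\<close> followed by \<open>(u, v, w)\<close>: the entries are those of the product of
  the trace-free matrices with rows \<open>(v, -u)\<close>, \<open>(w, -v)\<close> and \<open>(v', -u')\<close>, \<open>(w', -v')\<close>.
\<close>
definition composition_graph ::
    "real \<Rightarrow> real \<Rightarrow> real \<Rightarrow> real \<Rightarrow> real \<Rightarrow> real \<Rightarrow> (real \<times> real) set" where
  "composition_graph u v w u' v' w' =
     mobius_graph (v * v' - u * w') (u * v' - v * u') (w * v' - v * w') (v * v' - w * u')"

text \<open>Multiplicativity of the determinant.\<close>

lemma composition_det:
  fixes u v w u' v' w' :: real
  assumes "u * w \<noteq> v\<^sup>2" "u' * w' \<noteq> v'\<^sup>2"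
  shows "(v * v' - u * w') * (v * v' - w * u') \<noteq> (u * v' - v * u') * (w * v' - v * w')"
proof -
  have "(v * v' - u * w') * (v * v' - w * u') - (u * v' - v * u') * (w * v' - v * w')
      = (u * w - v\<^sup>2) * (u' * w' - v'\<^sup>2)" by algebra
  then show ?thesis using assms by auto
qed

lemma composition_graph_contains:
  assumes "involution_pair u' v' w' x y" "involution_pair u v w y z"
  shows "(x, z) \<in> composition_graph u v w u' v' w'"
proof -
  \<comment> \<open>The multipliers \<open>w' * x - v'\<close> and \<open>w * z - v\<close> are the
    coefficients of \<open>y\<close> in the two relations, so that \<open>y\<close> cancels.\<close>
  have "(w * v' - v * w') * x * z + (v * v' - w * u') * z = (v * v' - u * w') * x + (u * v' - v * u')
     \<longleftrightarrow> (w' * x - v') * (w * y * z - v * (y + z) + u) - (w * z - v) * (w' * x * y - v' * (x + y) + u') = 0"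
    by (auto simp: algebra_simps)
  then show ?thesis
    using assms by (simp add: composition_graph_def mobius_graph_def involution_pair_def)
qed

text \<open>
  Two trace-free matrices \<open>M\<close>, \<open>M'\<close> satisfy \<open>tr (M M' M') = 0\<close>, so \<open>M'\<close> lies in a plane depending
  only on the product \<open>M M'\<close>, unless this product is scalar.
\<close>
lemma composition_axis:
  fixes u v w u' v' w' :: real
  assumes "(v * v' - u * w') = k * a" "(u * v' - v * u') = k * b"
    "(w * v' - v * w') = k * c" "(v * v' - w * u') = k * d" "k \<noteq> 0"
  shows "(- c) * u' + (a - d) * v' + b * w' = 0"
proof -
  have "k * ((- c) * u' + (a - d) * v' + b * w') = 0" using assms(1-4) by algebra
  then show ?thesis using assms(5) by simp
qed

text \<open>Nondegeneracy rules out \<open>u' = v' = 0\<close>, so \<open>u / u'\<close> or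
  \<open>v / v'\<close> can serve as the factor.\<close>

lemma parallel_if_cross_eq_0:
  fixes u v w u' v' w' :: real
  assumes "u * w' = w * u'" "u * v' = v * u'" "w * v' = v * w'" "u' * w' \<noteq> v'\<^sup>2"
  shows "\<exists>k. u = k * u' \<and> v = k * v' \<and> w = k * w'"
proof -
  consider "u' \<noteq> 0" | "v' \<noteq> 0" using assms(4) by (cases "u' = 0") auto
  then show ?thesis
  proof cases
    case 1
    then show ?thesis using assms by (intro exI[of _ "u / u'"]) (simp add: field_simps)
  next
    case 2
    then show ?thesis using assms by (intro exI[of _ "v / v'"]) (simp add: field_simps)
  qed
qed

text \<open>The square of a trace-free matrix is scalar, here \<open>v'^2 - u' w'\<close>;
  multiplying both products by the right factor once more therefore cancels it.\<close>

lemma composition_right_cancel: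
  fixes u v w u' v' w' u2 v2 w2 :: real
  assumes "v2 * v' - u2 * w' = k * (v * v' - u * w')" "u2 * v' - v2 * u' = k * (u * v' - v * u')"
    "w2 * v' - v2 * w' = k * (w * v' - v * w')" "v2 * v' - w2 * u' = k * (v * v' - w * u')"
    and "u' * w' \<noteq> v'\<^sup>2"
  shows "u2 = k * u \<and> v2 = k * v \<and> w2 = k * w"
proof -
  have "(v'\<^sup>2 - u' * w') * (u2 - k * u) = 0" "(v'\<^sup>2 - u' * w') * (v2 - k * v) = 0"
    "(v'\<^sup>2 - u' * w') * (w2 - k * w) = 0"
    using assms(1-4) by algebra+
  then show ?thesis using assms(5) by simp
qed

text \<open>Each common \<open>y\<close> is the middle of a path \<open>x\<close>, \<open>y\<close>,
  \<open>z\<close> in \<open>X\<close> and yields the graph point \<open>(x, z)\<close>. Nothing is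
  lost, since the first involution recovers \<open>y\<close> from \<open>x\<close>.\<close>

lemma card_common_le_composition:
  assumes "finite X" "u * w \<noteq> v\<^sup>2" "u' * w' \<noteq> v'\<^sup>2"
  shows "card ({y \<in> X. \<exists>x\<in>X. involution_pair u' v' w' y x} \<inter> {y \<in> X. \<exists>x\<in>X. involution_pair u v w y x})
      \<le> card (X \<times> X \<inter> composition_graph u v w u' v' w')" (is "card ?Y \<le> card ?G")
proof (rule surj_card_le)
  show "finite ?G" using assms(1) by simp
  show "?Y \<subseteq> (\<lambda>p. THE y. involution_pair u' v' w' (fst p) y) ` ?G"
  proof
    fix y assume "y \<in> ?Y"
    then obtain x z where xz: "x \<in> X" "z \<in> X" "involution_pair u' v' w' y x" "involution_pair u v w y z"
      by blast
    then have xy: "involution_pair u' v' w' x y" by (simp add: involution_pair_def algebra_simps)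
    then have "(THE y. involution_pair u' v' w' x y) = y"
      using involution_pair_unique[OF assms(3)] by blast
    moreover have "(x, z) \<in> ?G" using composition_graph_contains[OF xy xz(4)] xz by blast
    ultimately show "y \<in> (\<lambda>p. THE y. involution_pair u' v' w' (fst p) y) ` ?G"
      by (intro image_eqI[of _ _ "(x, z)"]) simp_all
  qed
qed

section \<open>Rich pairs and coaxial involutions\<close>

text \<open>Cauchy-Schwarz bounds the sum over all pairs below by \<open>n^3 / (4 C)\<close>. Pairs
  under the threshold \<open>n / (16 C^3)\<close> account for at most a quarter of this, and the
  lower bound on \<open>n\<close> makes the diagonal negligible. Each remaining pair contributes at
  most \<open>C n\<close>.\<close>

lemma card_rich_pairs:
  fixes u v w :: "'a \<Rightarrow> real" and X :: "real set" and C n :: real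
  defines "N \<equiv> \<lambda>P. {y \<in> X. \<exists>x\<in>X. involution_pair (u P) (v P) (w P) y x}"
  assumes C: "C > 1" and n: "n \<ge> 512 * C ^ 3"
    and H: "finite H" "card H \<le> C * n" and X: "finite X" "card X \<le> C * n"
    and incid: "n\<^sup>2 / 2 \<le> (\<Sum>P\<in>H. real (card (N P)))"
  shows "n\<^sup>2 \<le> 16 * C\<^sup>2 * card {(P, Q). P \<in> H \<and> Q \<in> H \<and> P \<noteq> Q \<and> n \<le> 16 * C ^ 3 * card (N P \<inter> N Q)}"
    (is "_ \<le> _ * real (card ?R)")
proof -
  have n0: "n > 0" using n C by (smt (verit) zero_less_power)
  have R: "?R \<subseteq> H \<times> H" by auto
  then have finR: "finite ?R" using H(1) finite_subset by blast
  have N: "N P \<subseteq> X" for P unfolding N_def by blast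
  have r_le: "real (card (N P \<inter> N Q)) \<le> C * n" for P Q
    using card_mono[OF X(1), of "N P \<inter> N Q"] N[of P] X(2) by fastforce
  have "(n\<^sup>2 / 2)\<^sup>2 \<le> (\<Sum>P\<in>H. real (card (N P)))\<^sup>2"
    using incid by (intro power_mono) auto
  also have "\<dots> \<le> card X * (\<Sum>P\<in>H. \<Sum>Q\<in>H. real (card (N P \<inter> N Q)))"
    by (rule sum_card_squared_le_energy[OF X(1) N])
  also have "\<dots> \<le> (C * n) * (\<Sum>P\<in>H. \<Sum>Q\<in>H. real (card (N P \<inter> N Q)))"
    using X(2) by (intro mult_right_mono sum_nonneg) auto
  finally have E: "(n\<^sup>2 / 2)\<^sup>2 \<le> (C * n) * (\<Sum>P\<in>H. \<Sum>Q\<in>H. real (card (N P \<inter> N Q)))" .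
  have "(\<Sum>P\<in>H. \<Sum>Q\<in>H. real (card (N P \<inter> N Q)))
      = (\<Sum>(P, Q)\<in>H \<times> H. real (card (N P \<inter> N Q)))"
    by (simp add: sum.cartesian_product)
  \<comment> \<open>The three summands bound the diagonal, the poor pairs and the rich
    pairs.\<close>
  also have "\<dots> \<le> (\<Sum>p\<in>H \<times> H. C * n * of_bool (fst p = snd p) + n / (16 * C ^ 3)
      + C * n * of_bool (p \<in> ?R))"
  proof (rule sum_mono, clarify)
    fix P Q assume PQ: "P \<in> H" "Q \<in> H"
    have pos: "C * n \<ge> 0" "n / (16 * C ^ 3) \<ge> 0" using n0 C by simp_all
    have nonneg: "C * n * of_bool A \<ge> 0" for A using pos(1) by simp
    consider "P = Q" | "(P, Q) \<in> ?R" | "16 * C ^ 3 * card (N P \<inter> N Q) < n"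
      using PQ by force
    then show "real (card (N P \<inter> N Q)) \<le> C * n * of_bool (fst (P, Q) = snd (P, Q)) + n / (16 * C ^ 3)
      + C * n * of_bool ((P, Q) \<in> ?R)"
    proof cases
      case 1
      then show ?thesis using r_le[of P Q] pos nonneg[of "(P, Q) \<in> ?R"] by simp
    next
      case 2
      then have "C * n * of_bool ((P, Q) \<in> ?R) = C * n" by (simp only: of_bool_eq mult_1_right)
      then show ?thesis using r_le[of P Q] pos nonneg[of "fst (P, Q) = snd (P, Q)"] by linarith
    next
      case 3
      then have "real (card (N P \<inter> N Q)) \<le> n / (16 * C ^ 3)"
        using C by (simp add: field_simps)
      then show ?thesis
        using nonneg[of "fst (P, Q) = snd (P, Q)"] nonneg[of "(P, Q) \<in> ?R"] by linarith
    qed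
  qed
  also have "\<dots> = C * n * card H + (real (card H))\<^sup>2 * (n / (16 * C ^ 3)) + C * n * card ?R"
  proof -
    have "(\<Sum>p\<in>H \<times> H. of_bool (fst p = snd p) :: real) = (\<Sum>P\<in>H. \<Sum>Q\<in>H. of_bool (P = Q))"
      by (simp add: sum.cartesian_product case_prod_beta)
    also have "\<dots> = card H" using H(1) by (simp add: of_bool_def)
    finally have diag: "(\<Sum>p\<in>H \<times> H. of_bool (fst p = snd p) :: real) = card H" .
    have "(\<Sum>p\<in>H \<times> H. of_bool (p \<in> ?R) :: real) = card ?R"
      using H(1) R by (subst sum_of_bool_eq) (auto simp: Int_absorb1 simp del: mem_Collect_eq)
    then show ?thesis
      using diag unfolding sum.distrib sum_distrib_left[symmetric]
      by (simp add: card_cartesian_product power2_eq_square)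
  qed
  also have "\<dots> \<le> C * n * (C * n) + (C * n)\<^sup>2 * (n / (16 * C ^ 3)) + C * n * card ?R"
    using H(2) C n0 by (intro add_mono mult_left_mono mult_right_mono power_mono) auto
  finally have F: "(\<Sum>P\<in>H. \<Sum>Q\<in>H. real (card (N P \<inter> N Q)))
     \<le> C * n * (C * n) + (C * n)\<^sup>2 * (n / (16 * C ^ 3)) + C * n * card ?R" .
  have "(n\<^sup>2 / 2)\<^sup>2 \<le> (C * n) * (C * n * (C * n) + (C * n)\<^sup>2 * (n / (16 * C ^ 3)) + C * n * card ?R)"
    using E F C n0 by (smt (verit) mult_left_mono mult_pos_pos)
  also have "\<dots> = n\<^sup>2 * (C ^ 3 * n + n\<^sup>2 / 16 + C\<^sup>2 * card ?R)"
    using C by (simp add: field_simps power2_eq_square power3_eq_cube)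
  finally have "n\<^sup>2 * (n\<^sup>2 / 4) \<le> n\<^sup>2 * (C ^ 3 * n + n\<^sup>2 / 16 + C\<^sup>2 * card ?R)"
    by (simp add: power_divide power2_eq_square)
  then have "n\<^sup>2 / 4 \<le> C ^ 3 * n + n\<^sup>2 / 16 + C\<^sup>2 * card ?R"
    by (rule mult_left_le_imp_le) (use n0 in simp)
  moreover have "C ^ 3 * n \<le> n\<^sup>2 / 512"
    using mult_right_mono[OF n, of n] n0 by (simp add: power2_eq_square)
  ultimately show ?thesis using zero_le_power2[of n] by linarith
qed

text \<open>Pigeonhole: at least \<open>n^2 / (16 C^2)\<close> rich pairs share at most
  \<open>n s^6 / (2048 C^3)\<close> graphs. Assumption \<open>inj\<close> says that distinct
  elements of \<open>H\<close> have non-proportional coordinates.\<close>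

lemma coaxial_involutions:
  fixes u v w :: "'a \<Rightarrow> real" and X :: "real set" and C n :: real and s :: nat
  assumes C: "C > 1" and n: "n \<ge> 512 * C ^ 3" and s: "s \<ge> 512 * C ^ 4"
    and H: "finite H" "card H \<le> C * n" and X: "finite X" "card X \<le> C * n"
    and nondeg: "\<And>P. P \<in> H \<Longrightarrow> u P * w P \<noteq> (v P)\<^sup>2"
    and inj: "\<And>P Q k. \<lbrakk>P \<in> H; Q \<in> H; u P = k * u Q; v P = k * v Q; w P = k * w Q\<rbrakk> \<Longrightarrow> P = Q"
    and incid: "n\<^sup>2 / 2 \<le> (\<Sum>P\<in>H. real (card {y \<in> X. \<exists>x\<in>X. involution_pair (u P) (v P) (w P) y x}))"
  obtains T \<alpha> \<beta> \<gamma> where "T \<subseteq> H" "(\<alpha>, \<beta>, \<gamma>) \<noteq> (0, 0, 0)"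
    "\<And>P. P \<in> T \<Longrightarrow> \<alpha> * u P + \<beta> * v P + \<gamma> * w P = 0" "128 * C * n \<le> s ^ 6 * card T"
proof -
  define \<epsilon> where "\<epsilon> = 1 / (16 * C ^ 3)"
  have \<epsilon>: "\<epsilon> > 0" using C by (simp add: \<epsilon>_def)
  have C4: "C ^ 4 > 0" using C by simp
  have n0: "n > 0" using n C by (smt (verit) zero_less_power)
  have s0: "s > 0" using s C4 by (cases s) auto
  define N where "N P = {y \<in> X. \<exists>x\<in>X. involution_pair (u P) (v P) (w P) y x}" for P
  define R where "R = {(P, Q). P \<in> H \<and> Q \<in> H \<and> P \<noteq> Q \<and> n \<le> 16 * C ^ 3 * card (N P \<inter> N Q)}"
  have finR: "finite R" by (rule finite_subset[of _ "H \<times> H"]) (auto simp: R_def H(1))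
  have "n\<^sup>2 \<le> 16 * C\<^sup>2 * card R"
    unfolding R_def N_def by (rule card_rich_pairs[OF C n H X incid])
  then have cardR: "n\<^sup>2 / (16 * C\<^sup>2) \<le> card R" using C by (simp add: field_simps)
  then have R0: "R \<noteq> {}" using n0 C by (auto simp: field_simps)
  \<comment> \<open>The involution of \<open>P\<close> acts first, so \<open>P\<close> supplies the
    right factor, which is the one constrained by \<open>composition_axis\<close>.\<close>
  define G where "G = (\<lambda>(P, Q). composition_graph (u Q) (v Q) (w Q) (u P) (v P) (w P))"
  define \<Phi> where "\<Phi> p = X \<times> X \<inter> G p" for p
  define m where "m = nat \<lceil>\<epsilon> * n\<rceil>"
  define t where "t = card X div s + 1"
  have rich: "m \<le> card (\<Phi> p)" if "p \<in> R" for p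
  proof -
    obtain P Q where p: "p = (P, Q)" by (cases p)
    have "\<epsilon> * n \<le> card (N P \<inter> N Q)"
      using that C by (simp add: p R_def \<epsilon>_def field_simps)
    also have "card (N P \<inter> N Q) \<le> card (\<Phi> p)"
      using that unfolding p \<Phi>_def G_def N_def R_def split_conv
      by (intro card_common_le_composition X nondeg) auto
    finally show ?thesis by (simp add: m_def nat_le_iff ceiling_le_iff)
  qed
  have proportional: "\<exists>k. v Q' * v P' - u Q' * w P' = k * (v Q * v P - u Q * w P)
      \<and> u Q' * v P' - v Q' * u P' = k * (u Q * v P - v Q * u P)
      \<and> w Q' * v P' - v Q' * w P' = k * (w Q * v P - v Q * w P)
      \<and> v Q' * v P' - w Q' * u P' = k * (v Q * v P - w Q * u P)"
    if pp: "(P, Q) \<in> R" "(P', Q') \<in> R" and "\<tau> \<subseteq> \<Phi> (P, Q) \<inter> \<Phi> (P', Q')" "card \<tau> = 3" for P Q P' Q' \<tau>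
  proof -
    obtain x y z where xyz: "\<tau> = {x, y, z}" "x \<noteq> y" "y \<noteq> z" "x \<noteq> z"
      using \<open>card \<tau> = 3\<close> by (auto simp: card_3_iff)
    have "P \<in> H" "Q \<in> H" "P' \<in> H" "Q' \<in> H" using pp by (auto simp: R_def)
    then show ?thesis
      using that(3) xyz unfolding \<Phi>_def G_def composition_graph_def split_conv
      by (intro mobius_graph_coefficients[of _ _ _ _ _ _ _ _ x y z] composition_det nondeg) auto
  qed
  have few_curves: "card (\<Phi> ` R) * (m - 8 * t) \<le> t\<^sup>2 * s ^ 6"
  proof (rule card_rich_curves[OF X(1) s0 _ _ _ _ t_def])
    show "\<exists>G1 G2. K = G1 \<union> G2 \<and> monotone_either G1 \<and> monotone_either G2" if "K \<in> \<Phi> ` R" for K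
      using that unfolding \<Phi>_def G_def composition_graph_def
      by (clarsimp, intro mobius_graph_two_branches[OF composition_det]) (auto simp: R_def nondeg)
    show "K = K'" if "K \<in> \<Phi> ` R" "K' \<in> \<Phi> ` R" "\<tau> \<subseteq> K \<inter> K'" "card \<tau> = 3" for K K' \<tau>
    proof -
      obtain P Q P' Q' where pq: "(P, Q) \<in> R" "(P', Q') \<in> R" "K = \<Phi> (P, Q)" "K' = \<Phi> (P', Q')"
        using \<open>K \<in> \<Phi> ` R\<close> \<open>K' \<in> \<Phi> ` R\<close> by auto
      \<comment> \<open>Multiplying the graph equation by \<open>k\<close> gives this inclusion even
        for \<open>k = 0\<close>; the reverse one follows by exchanging the pairs.\<close>
      have sub: "\<Phi> (P, Q) \<subseteq> \<Phi> (P', Q')"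
        if R2: "(P, Q) \<in> R" "(P', Q') \<in> R" "\<tau> \<subseteq> \<Phi> (P, Q) \<inter> \<Phi> (P', Q')" for P Q P' Q'
      proof -
        obtain k where k: "v Q' * v P' - u Q' * w P' = k * (v Q * v P - u Q * w P)"
          "u Q' * v P' - v Q' * u P' = k * (u Q * v P - v Q * u P)"
          "w Q' * v P' - v Q' * w P' = k * (w Q * v P - v Q * w P)"
          "v Q' * v P' - w Q' * u P' = k * (v Q * v P - w Q * u P)"
          using proportional[OF R2 \<open>card \<tau> = 3\<close>] by blast
        have "G (P, Q) \<subseteq> G (P', Q')"
          unfolding G_def composition_graph_def mobius_graph_def split_conv k
          by (auto simp: mult.assoc simp flip: distrib_left)
        then show ?thesis unfolding \<Phi>_def by blast
      qed
      show ?thesis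
        using sub[OF pq(1,2)] sub[OF pq(2,1)] that(3) unfolding pq(3,4) by blast
    qed
  qed (use rich in \<open>auto simp: \<Phi>_def\<close>)
  \<comment> \<open>The bound on \<open>s\<close> gives
    \<open>t \<le> \<epsilon> n / 32 + 1\<close>, and the bound on \<open>n\<close> absorbs the 1.
    So \<open>8 * t\<close> uses up at most half of the richness
    \<open>\<epsilon> n\<close>.\<close>
  have t_le: "8 * real t \<le> \<epsilon> * n / 2"
  proof -
    have "real (card X div s) \<le> real (card X) / s" by (rule of_nat_div_le_of_nat)
    also have "\<dots> \<le> C * n / (512 * C ^ 4)"
      using X(2) s C4 n0 C by (intro frac_le) auto
    also have "\<dots> = \<epsilon> * n / 32" using C by (simp add: \<epsilon>_def field_simps power_numeral_reduce)
    finally have "real t \<le> \<epsilon> * n / 32 + 1" unfolding t_def by simp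
    moreover have "1 \<le> \<epsilon> * n / 32" using n C by (simp add: \<epsilon>_def field_simps)
    ultimately show ?thesis by linarith
  qed
  have "card (\<Phi> ` R) * (\<epsilon> * n / 2) \<le> card (\<Phi> ` R) * real (m - 8 * t)"
  proof (rule mult_left_mono)
    have "\<epsilon> * n \<le> real m" unfolding m_def by (rule real_nat_ceiling_ge)
    then show "\<epsilon> * n / 2 \<le> real (m - 8 * t)" using t_le by linarith
  qed simp
  also have "\<dots> \<le> (real t)\<^sup>2 * s ^ 6"
    using few_curves by (metis of_nat_le_iff of_nat_mult of_nat_power)
  also have "\<dots> \<le> (\<epsilon> * n / 16)\<^sup>2 * s ^ 6"
    using t_le by (intro mult_right_mono power_mono) auto
  also have "\<dots> = (\<epsilon> * n / 2) * (\<epsilon> * n * s ^ 6 / 128)" by (simp add: power2_eq_square)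
  finally have "card (\<Phi> ` R) * (\<epsilon> * n / 2) \<le> (\<epsilon> * n * s ^ 6 / 128) * (\<epsilon> * n / 2)"
    by (simp only: mult.commute)
  then have curves: "card (\<Phi> ` R) \<le> \<epsilon> * n * s ^ 6 / 128"
    using \<epsilon> n0 by (simp add: mult_le_cancel_right ac_simps)
  obtain K where K: "K \<in> \<Phi> ` R" "card R \<le> card (\<Phi> ` R) * card {p \<in> R. \<Phi> p = K}"
    by (rule pigeonhole_fiber[OF finR R0])
  define F where "F = {p \<in> R. \<Phi> p = K}"
  obtain P0 Q0 where PQ0: "(P0, Q0) \<in> F" using K(1) unfolding F_def by auto
  \<comment> \<open>Three points of \<open>K\<close> are needed to fix the matrix up to a
    factor.\<close>
  have m3: "m \<ge> 3"
  proof -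
    have "32 \<le> \<epsilon> * n" using n C by (simp add: \<epsilon>_def field_simps)
    then show ?thesis unfolding m_def by linarith
  qed
  have "finite K" using K(1) X(1) by (auto simp: \<Phi>_def)
  moreover have "3 \<le> card K" using rich m3 K(1) by force
  ultimately obtain \<tau> where \<tau>: "\<tau> \<subseteq> K" "card \<tau> = 3" by (meson obtain_subset_with_card_n)
  have F_prop: "\<exists>k. v Q' * v P' - u Q' * w P' = k * (v Q * v P - u Q * w P)
      \<and> u Q' * v P' - v Q' * u P' = k * (u Q * v P - v Q * u P)
      \<and> w Q' * v P' - v Q' * w P' = k * (w Q * v P - v Q * w P)
      \<and> v Q' * v P' - w Q' * u P' = k * (v Q * v P - w Q * u P)"
    if "(P, Q) \<in> F" "(P', Q') \<in> F" for P Q P' Q'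
    using that \<tau> unfolding F_def by (intro proportional[of _ _ _ _ \<tau>]) auto
  have FH: "P \<in> H" "Q \<in> H" "P \<noteq> Q" if "(P, Q) \<in> F" for P Q using that by (auto simp: F_def R_def)
  \<comment> \<open>Given \<open>P\<close>, the common product determines the matrix of
    \<open>Q\<close> up to a factor, hence \<open>Q\<close>. So the first components are as numerous
    as the pairs.\<close>
  have "inj_on fst F"
  proof (rule inj_onI, clarsimp)
    fix P Q Q' assume *: "(P, Q) \<in> F" "(P, Q') \<in> F"
    then obtain k where "v Q' * v P - u Q' * w P = k * (v Q * v P - u Q * w P)"
      "u Q' * v P - v Q' * u P = k * (u Q * v P - v Q * u P)"
      "w Q' * v P - v Q' * w P = k * (w Q * v P - v Q * w P)"
      "v Q' * v P - w Q' * u P = k * (v Q * v P - w Q * u P)"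
      using F_prop by blast
    from composition_right_cancel[OF this nondeg] * show "Q = Q'"
      using inj FH by metis
  qed
  then have cardF: "card (fst ` F) = card F" by (rule card_image)
  define a where "a = v Q0 * v P0 - u Q0 * w P0"
  define b where "b = u Q0 * v P0 - v Q0 * u P0"
  define c where "c = w Q0 * v P0 - v Q0 * w P0"
  define d where "d = v Q0 * v P0 - w Q0 * u P0"
  show ?thesis
  proof (rule that[of "fst ` F" "- c" "a - d" b])
    show "fst ` F \<subseteq> H" using FH by auto
    \<comment> \<open>If this vector vanished, the product would be scalar and the two involutions
      would coincide, against \<open>P0 \<noteq> Q0\<close>.\<close>
    show "(- c, a - d, b) \<noteq> (0, 0, 0)"
    proof
      assume "(- c, a - d, b) = (0, 0, 0)"
      then have "\<exists>k. u Q0 = k * u P0 \<and> v Q0 = k * v P0 \<and> w Q0 = k * w P0"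
        using nondeg[OF FH(1)[OF PQ0]]
        by (intro parallel_if_cross_eq_0) (auto simp: a_def b_def c_def d_def)
      then show False using inj FH[OF PQ0] by blast
    qed
    show "- c * u P + (a - d) * v P + b * w P = 0" if PF: "P \<in> fst ` F" for P
    proof -
      obtain Q where PQ: "(P, Q) \<in> F" using PF by auto
      obtain k where k: "v Q * v P - u Q * w P = k * a" "u Q * v P - v Q * u P = k * b"
        "w Q * v P - v Q * w P = k * c" "v Q * v P - w Q * u P = k * d"
        using F_prop[OF PQ0 PQ] unfolding a_def b_def c_def d_def by blast
      \<comment> \<open>For \<open>k = 0\<close> the product for \<open>(P, Q)\<close> would be the
        zero matrix, but its determinant is nonzero.\<close>
      have "k \<noteq> 0"
        using composition_det[OF nondeg[OF FH(2)[OF PQ]] nondeg[OF FH(1)[OF PQ]]] k by auto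
      with k show ?thesis by (rule composition_axis)
    qed
    have "n\<^sup>2 / (16 * C\<^sup>2) \<le> real (card (\<Phi> ` R)) * card F"
      using cardR of_nat_mono[OF K(2), where 'a = real] by (simp add: F_def)
    also have "\<dots> \<le> (\<epsilon> * n * s ^ 6 / 128) * card F"
      using curves by (intro mult_right_mono) auto
    finally have "n * (128 * C * n) \<le> n * (s ^ 6 * card F)"
      using C by (simp add: \<epsilon>_def field_simps power2_eq_square power3_eq_cube)
    then show "128 * C * n \<le> s ^ 6 * card (fst ` F)"
      using n0 cardF by simp
  qed
qed

subsection \<open>Points and lines of a conic\<close>

definition homogeneous :: "real^2 \<Rightarrow> real^3" where
  "homogeneous p = vector [p $ 1, p $ 2, 1]"

text \<open>Comparing third coordinates gives \<open>k = 1\<close>.\<close>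

lemma homogeneous_eq_scaleR:
  assumes "homogeneous p = k *\<^sub>R homogeneous q"
  shows "p = q"
  using assms by (auto simp: homogeneous_def vec_eq_iff forall_3 forall_2)

lemma homogeneous_affine:
  "homogeneous ((1 - t) *\<^sub>R p + t *\<^sub>R q) = (1 - t) *\<^sub>R homogeneous p + t *\<^sub>R homogeneous q"
  by (simp add: homogeneous_def vec_eq_iff forall_3)

text \<open>
  This is \<open>det (M\<^sup>T A M) = det A (det M)\<^sup>2\<close> for the matrix \<open>M\<close> with columns \<open>p\<close>, \<open>q\<close>, \<open>x\<close>.
\<close>
lemma quadratic_form_isotropic_pair:
  fixes A :: "real^3^3"
  assumes sym: "transpose A = A"
    and "p \<bullet> (A *v p) = 0" "q \<bullet> (A *v q) = 0" "p \<bullet> (A *v q) = 1"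
  shows "x \<bullet> (A *v x) = 2 * ((A *v p) \<bullet> x) * ((A *v q) \<bullet> x) - det A * (cross3 p q \<bullet> x)\<^sup>2"
proof -
  have symm: "y \<bullet> (A *v z) = z \<bullet> (A *v y)" for y z
    by (metis dot_lmul_matrix inner_commute sym transpose_matrix_vector)
  define M where "M = transpose (vector [p, q, x] :: real^3^3)"
  have M: "column 1 M = p" "column 2 M = q" "column 3 M = x"
    by (simp_all add: M_def column_def transpose_def vec_eq_iff)
  have entry: "(transpose M ** A ** M) $ i $ j = column i M \<bullet> (A *v column j M)" for i j
    by (simp add: matrix_matrix_mult_def matrix_vector_mult_def column_def transpose_def
        inner_vec_def sum_3 algebra_simps)
  have "det M = cross3 p q \<bullet> x"
    unfolding M_def det_transpose by (simp add: cross3_simps)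
  then have "det (transpose M ** A ** M) = det A * (cross3 p q \<bullet> x)\<^sup>2"
    by (simp add: det_mul det_transpose power2_eq_square)
  \<comment> \<open>The Gram matrix of \<open>p\<close>, \<open>q\<close>, \<open>x\<close> has
    first two rows \<open>(0, 1, p \<bullet> (A *v x))\<close> and
    \<open>(1, 0, q \<bullet> (A *v x))\<close>.\<close>
  moreover have "det (transpose M ** A ** M) = 2 * (x \<bullet> (A *v p)) * (x \<bullet> (A *v q)) - x \<bullet> (A *v x)"
    unfolding det_3 entry M using assms(2-4) symm[of p x] symm[of q x] symm[of q p] by simp
  ultimately show ?thesis by (simp add: inner_commute)
qed

text \<open>A point \<open>p\<close> of the conic is completed to a hyperbolic pair
  \<open>p\<close>, \<open>q\<close>. Up to scaling, \<open>h\<close> and \<open>f\<close> are the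
  tangents at \<open>p\<close> and \<open>q\<close>, and \<open>g\<close> is the chord joining
  them.\<close>

lemma nondegenerate_conic_normal_form:
  assumes "nondegenerate_conic S"
  obtains f g h :: "real^3" where "det (vector [f, g, h] :: real^3^3) \<noteq> 0"
    "S = {p. (f \<bullet> homogeneous p) * (h \<bullet> homogeneous p) = (g \<bullet> homogeneous p)\<^sup>2}"
proof -
  obtain A :: "real^3^3" where sym: "transpose A = A" and det: "det A \<noteq> 0"
    and S: "S = {p. homogeneous p \<bullet> (A *v homogeneous p) = 0}"
    using assms unfolding nondegenerate_conic_def homogeneous_def by blast
  obtain p0 where "p0 \<in> S" using assms unfolding nondegenerate_conic_def by blast
  define p where "p = homogeneous p0"
  have p: "p \<bullet> (A *v p) = 0" using \<open>p0 \<in> S\<close> by (simp add: S p_def)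
  have symm: "y \<bullet> (A *v z) = z \<bullet> (A *v y)" for y z
    by (metis dot_lmul_matrix inner_commute sym transpose_matrix_vector)
  have "p $ 3 = 1" by (simp add: p_def homogeneous_def)
  then have "p \<noteq> 0" by auto
  then have Ap: "A *v p \<noteq> 0"
    using det by (metis invertible_det_nz invertible_left_inverse matrix_left_invertible_ker)
  define r where "r = (1 / ((A *v p) \<bullet> (A *v p))) *\<^sub>R (A *v p)"
  have r: "p \<bullet> (A *v r) = 1"
    using Ap by (subst symm) (simp add: r_def)
  \<comment> \<open>Since \<open>p\<close> is isotropic, subtracting a multiple of it keeps the
    product with \<open>p\<close> equal to 1; this multiple makes \<open>q\<close>
    isotropic.\<close>
  define q where "q = r - (r \<bullet> (A *v r) / 2) *\<^sub>R p"
  have Aq: "A *v q = A *v r - (r \<bullet> (A *v r) / 2) *\<^sub>R (A *v p)"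
    by (simp add: q_def matrix_vector_mult_diff_distrib matrix_vector_mult_scaleR)
  have pq: "p \<bullet> (A *v q) = 1" using p r by (simp add: Aq inner_diff_right)
  have q: "q \<bullet> (A *v q) = 0"
    unfolding Aq using p r symm[of r p] by (simp add: q_def inner_diff_right inner_diff_left)
  define f where "f = (2 / det A) *\<^sub>R (A *v q)"
  have "det (vector [f, cross3 p q, A *v p] :: real^3^3) = cross3 p q \<bullet> cross3 (A *v p) f"
    unfolding dot_cross_det[symmetric] by (simp add: cross3_simps)
  also have "\<dots> = (2 / det A) * (cross3 p q \<bullet> cross3 (A *v p) (A *v q))"
    by (simp add: f_def cross_mult_right)
  \<comment> \<open>By the Binet-Cauchy identity the dot product of the two cross products is
    -1.\<close>
  also have "\<dots> = - 2 / det A"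
    unfolding dot_cross using p q pq symm[of q p] by simp
  finally have 1: "det (vector [f, cross3 p q, A *v p] :: real^3^3) \<noteq> 0" using det by simp
  have "x \<bullet> (A *v x) = 0 \<longleftrightarrow> (f \<bullet> x) * ((A *v p) \<bullet> x) = (cross3 p q \<bullet> x)\<^sup>2" for x
    unfolding quadratic_form_isotropic_pair[OF sym p q pq] f_def using det by (simp add: field_simps)
  with 1 show ?thesis using that[OF 1] unfolding S by blast
qed

text \<open>If the first two coordinates of \<open>z\<close> vanish, it is the line at infinity and
  \<open>T\<close> is empty. Otherwise all differences of points of \<open>T\<close> are multiples
  of the direction \<open>e\<close>.\<close>

lemma collinear_projective_line:
  fixes z :: "real^3"
  assumes "z \<noteq> 0" "\<And>p. p \<in> T \<Longrightarrow> z \<bullet> homogeneous p = 0"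
  shows "collinear T"
proof (cases "z $ 1 = 0 \<and> z $ 2 = 0")
  case True
  then have "z $ 3 \<noteq> 0" using assms(1) by (auto simp: vec_eq_iff forall_3)
  then have "T = {}" using assms(2) True by (auto simp: homogeneous_def inner_vec_def sum_3)
  then show ?thesis by simp
next
  case False
  let ?s = "(z $ 1)\<^sup>2 + (z $ 2)\<^sup>2"
  have s: "?s \<noteq> 0" using False by (simp add: sum_power2_eq_zero_iff)
  define e :: "real^2" where "e = vector [- z $ 2, z $ 1]"
  have "\<exists>c. p - q = c *\<^sub>R e" if "p \<in> T" "q \<in> T" for p q
  proof
    let ?c = "(z $ 1 * (p $ 2 - q $ 2) - z $ 2 * (p $ 1 - q $ 1)) / ?s"
    have "z $ 1 * p $ 1 + z $ 2 * p $ 2 + z $ 3 = 0" "z $ 1 * q $ 1 + z $ 2 * q $ 2 + z $ 3 = 0"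
      using assms(2) that by (auto simp: homogeneous_def inner_vec_def sum_3)
    then have "(p $ 1 - q $ 1) * ?s = (z $ 1 * (p $ 2 - q $ 2) - z $ 2 * (p $ 1 - q $ 1)) * (- z $ 2)"
      "(p $ 2 - q $ 2) * ?s = (z $ 1 * (p $ 2 - q $ 2) - z $ 2 * (p $ 1 - q $ 1)) * z $ 1"
      by algebra+
    then have "p $ 1 - q $ 1 = ?c * (- z $ 2)" "p $ 2 - q $ 2 = ?c * z $ 1"
      using s by (metis nonzero_eq_divide_eq times_divide_eq_left)+
    then show "p - q = ?c *\<^sub>R e" by (simp add: e_def vec_eq_iff forall_2)
  qed
  then show ?thesis unfolding collinear_def by blast
qed

lemma is_line_eq_affine_hull:
  assumes "is_line l" "p \<in> l" "q \<in> l" "p \<noteq> q"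
  shows "l = affine hull {p, q}"
proof (rule affine_dim_equal[symmetric])
  show "affine hull {p, q} \<subseteq> l"
    using assms unfolding is_line_def by (intro hull_minimal) auto
qed (use assms in \<open>auto simp: is_line_def\<close>)

text \<open>The involution relation for fixed \<open>r\<close>, \<open>s\<close> is linear in the
  coordinates of \<open>P\<close> and vanishes at \<open>(r^2, r, 1)\<close> and
  \<open>(s^2, s, 1)\<close>: it is the equation of the chord.\<close>

lemma involution_pair_if_collinear:
  assumes P: "P = (1 - t) *\<^sub>R x + t *\<^sub>R y"
    and x: "f \<bullet> homogeneous x = a * r\<^sup>2" "g \<bullet> homogeneous x = a * r" "h \<bullet> homogeneous x = a"
    and y: "f \<bullet> homogeneous y = b * s\<^sup>2" "g \<bullet> homogeneous y = b * s" "h \<bullet> homogeneous y = b"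
  shows "involution_pair (f \<bullet> homogeneous P) (g \<bullet> homogeneous P) (h \<bullet> homogeneous P) r s"
  unfolding P homogeneous_affine involution_pair_def inner_add_right inner_scaleR_right x y
  by algebra

section \<open>From lines to involutions and back\<close>

lemma many_collinear_of_triple_lines:
  fixes C n :: real and s :: nat
  assumes C: "C > 1" and n: "n \<ge> 512 * C ^ 3" and s: "s \<ge> 512 * C ^ 4"
    and H1: "finite H1" "card H1 \<le> C * n" and H2: "finite H2" "card H2 \<le> C * n"
    and S: "nondegenerate_conic S" "H2 \<subseteq> S" "S \<inter> H1 = {}"
    and lines: "n\<^sup>2 \<le> card (triple_lines H1 H2)"
  obtains T where "T \<subseteq> H1" "collinear T" "128 * C * n \<le> s ^ 6 * card T"
proof -
  obtain f g h :: "real^3" where det: "det (vector [f, g, h] :: real^3^3) \<noteq> 0"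
    and S_eq: "S = {p. (f \<bullet> homogeneous p) * (h \<bullet> homogeneous p) = (g \<bullet> homogeneous p)\<^sup>2}"
    using nondegenerate_conic_normal_form[OF S(1)] .
  define u v w where "u p = f \<bullet> homogeneous p" and "v p = g \<bullet> homogeneous p"
    and "w p = h \<bullet> homogeneous p" for p
  note uvw_defs = u_def v_def w_def
  have on_S: "p \<in> S \<longleftrightarrow> u p * w p = (v p)\<^sup>2" for p by (simp add: S_eq uvw_defs)
  have ker: "x = 0" if "f \<bullet> x = 0" "g \<bullet> x = 0" "h \<bullet> x = 0" for x
  proof -
    have "(vector [f, g, h] :: real^3^3) *v x = 0"
      using that by (simp add: vec_eq_iff forall_3 matrix_vector_mul_component)
    then show ?thesis
      using det by (metis invertible_det_nz invertible_left_inverse matrix_left_invertible_ker)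
  qed
  have inj: "p = q" if "u p = k * u q" "v p = k * v q" "w p = k * w q" for p q k
  proof -
    have "homogeneous p - k *\<^sub>R homogeneous q = 0"
      using that by (intro ker) (simp_all add: uvw_defs inner_diff_right)
    then show ?thesis by (intro homogeneous_eq_scaleR[of p k q]) simp
  qed
  have indep: "\<alpha> *\<^sub>R f + \<beta> *\<^sub>R g + \<gamma> *\<^sub>R h \<noteq> 0" if "(\<alpha>, \<beta>, \<gamma>) \<noteq> (0, 0, 0)" for \<alpha> \<beta> \<gamma>
  proof
    assume 0: "\<alpha> *\<^sub>R f + \<beta> *\<^sub>R g + \<gamma> *\<^sub>R h = 0"
    let ?D = "det (vector [f, g, h] :: real^3^3)"
    \<comment> \<open>Cramer's rule: each cross product is orthogonal to two of the three
      vectors.\<close>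
    have "\<alpha> * ?D = (\<alpha> *\<^sub>R f + \<beta> *\<^sub>R g + \<gamma> *\<^sub>R h) \<bullet> cross3 g h"
      "\<beta> * ?D = (\<alpha> *\<^sub>R f + \<beta> *\<^sub>R g + \<gamma> *\<^sub>R h) \<bullet> cross3 h f"
      "\<gamma> * ?D = (\<alpha> *\<^sub>R f + \<beta> *\<^sub>R g + \<gamma> *\<^sub>R h) \<bullet> cross3 f g"
      unfolding dot_cross_det[symmetric] by (simp_all add: cross3_simps)
    then show False using that det unfolding 0 by simp
  qed
  define \<tau> where "\<tau> p = v p / w p" for p
  have param: "u p = w p * (\<tau> p)\<^sup>2" "v p = w p * \<tau> p" if "p \<in> S" "w p \<noteq> 0" for p
    using that on_S[of p] by (simp_all add: \<tau>_def field_simps power2_eq_square)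
  define H2' where "H2' = {p \<in> H2. w p \<noteq> 0}"
  \<comment> \<open>A conic point with \<open>w p = 0\<close> has parameter infinity. There is at
    most one, and it is set aside so that the parameters in \<open>X\<close> are real.\<close>
  define E where "E = {p \<in> H2. w p = 0}"
  have E: "card E \<le> 1"
  proof -
    have "p = q" if "p \<in> E" "q \<in> E" for p q
    proof -
      have 0: "w p = 0" "w q = 0" "v p = 0" "v q = 0"
        using that S(2) on_S[of p] on_S[of q] by (auto simp: E_def)
      moreover have "u q \<noteq> 0"
        using ker[of "homogeneous q"] 0 by (auto simp: uvw_defs homogeneous_def vec_eq_iff forall_3)
      ultimately show ?thesis by (intro inj[of p "u p / u q" q]) simp_all
    qed
    then show ?thesis by (cases "finite E") (auto simp: card_le_Suc0_iff_eq)
  qed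
  have finH2': "finite H2'" and H2'S: "H2' \<subseteq> S" using H2(1) S(2) by (auto simp: H2'_def)
  have \<tau>_inj: "inj_on \<tau> H2'"
  proof (rule inj_onI)
    fix p q assume pq: "p \<in> H2'" "q \<in> H2'" "\<tau> p = \<tau> q"
    then have "p \<in> S" "w p \<noteq> 0" "q \<in> S" "w q \<noteq> 0" using H2'S by (auto simp: H2'_def)
    then show "p = q"
      using param[of p] param[of q] pq(3) by (intro inj[of p "w p / w q" q]) simp_all
  qed
  define X where "X = \<tau> ` H2'"
  have X: "finite X" "card X \<le> C * n"
  proof -
    show "finite X" using finH2' by (simp add: X_def)
    have "card X \<le> card H2"
      unfolding X_def using card_image_le[OF finH2', of \<tau>] card_mono[OF H2(1), of H2']
      by (auto simp: H2'_def)
    then show "card X \<le> C * n" using H2(2) by linarith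
  qed
  define N where "N P = {y \<in> X. \<exists>x\<in>X. involution_pair (u P) (v P) (w P) y x}" for P
  \<comment> \<open>A line is recovered from \<open>P\<close> and a single parameter, so each pair
    \<open>(P, y)\<close> with \<open>y\<close> in \<open>N P\<close> accounts for at most one
    line.\<close>
  let ?L = "\<lambda>P y. affine hull {P, the_inv_into H2' \<tau> y}"
  have sub: "triple_lines H1 H2 \<subseteq> (\<Union>P\<in>H1. ?L P ` N P) \<union> (\<lambda>(P, e). affine hull {P, e}) ` (H1 \<times> E)"
  proof
    fix l assume "l \<in> triple_lines H1 H2"
    then obtain P x y where l: "is_line l" "P \<noteq> x" "P \<noteq> y" "x \<noteq> y" "P \<in> l" "x \<in> l" "y \<in> l"
      "P \<in> H1" "x \<in> H2" "y \<in> H2" unfolding triple_lines_def by blast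
    note l_eq = is_line_eq_affine_hull[OF l(1)]
    show "l \<in> (\<Union>P\<in>H1. ?L P ` N P) \<union> (\<lambda>(P, e). affine hull {P, e}) ` (H1 \<times> E)"
    proof (cases "x \<in> E \<or> y \<in> E")
      case True
      then obtain e where "e \<in> E" "l = affine hull {P, e}" using l_eq l by blast
      then show ?thesis using l(8) by (intro UnI2 image_eqI[of _ _ "(P, e)"]) simp_all
    next
      case False
      then have xy: "x \<in> H2'" "y \<in> H2'" using l by (auto simp: E_def H2'_def)
      have "P \<in> affine hull {x, y}" using l_eq[of x y] l by blast
      then obtain t where P: "P = (1 - t) *\<^sub>R x + t *\<^sub>R y"
        by (auto simp: affine_hull_2) (metis add_diff_cancel_right')
      have "involution_pair (u P) (v P) (w P) (\<tau> x) (\<tau> y)"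
        unfolding uvw_defs
        by (rule involution_pair_if_collinear[OF P])
          (use param[of x] param[of y] xy H2'S in \<open>auto simp: H2'_def simp flip: uvw_defs\<close>)
      then have "\<tau> x \<in> N P" using xy by (auto simp: N_def X_def)
      moreover have "l = ?L P (\<tau> x)"
        using the_inv_into_f_f[OF \<tau>_inj xy(1)] l_eq[of P x] l by simp
      ultimately show ?thesis using l(8) by blast
    qed
  qed
  have finN: "finite (N P)" for P using X(1) by (simp add: N_def)
  have finE: "finite E" using H2(1) by (simp add: E_def)
  have "card (triple_lines H1 H2) \<le> card (\<Union>P\<in>H1. ?L P ` N P) + card ((\<lambda>(P, e). affine hull {P, e}) ` (H1 \<times> E))"
    using H1(1) finN finE by (intro order_trans[OF card_mono[OF _ sub] card_Un_le]) simp
  also have "\<dots> \<le> (\<Sum>P\<in>H1. card (N P)) + card H1"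
  proof (rule add_mono)
    have "card (\<Union>P\<in>H1. ?L P ` N P) \<le> (\<Sum>P\<in>H1. card (?L P ` N P))"
      by (rule card_UN_le[OF H1(1)])
    also have "\<dots> \<le> (\<Sum>P\<in>H1. card (N P))" by (intro sum_mono card_image_le finN)
    finally show "card (\<Union>P\<in>H1. ?L P ` N P) \<le> (\<Sum>P\<in>H1. card (N P))" .
    have "card ((\<lambda>(P, e). affine hull {P, e}) ` (H1 \<times> E)) \<le> card (H1 \<times> E)"
      using H1(1) finE by (intro card_image_le) simp
    also have "\<dots> \<le> card H1" using E by (simp add: card_cartesian_product)
    finally show "card ((\<lambda>(P, e). affine hull {P, e}) ` (H1 \<times> E)) \<le> card H1" .
  qed
  finally have "real (card (triple_lines H1 H2)) \<le> real ((\<Sum>P\<in>H1. card (N P)) + card H1)"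
    by (rule of_nat_mono)
  then have "n\<^sup>2 - C * n \<le> (\<Sum>P\<in>H1. real (card (N P)))"
    using lines H1(2) by simp
  \<comment> \<open>The lines through the point of \<open>E\<close> number at most
    \<open>C n\<close>, hence at most half of \<open>n^2\<close>.\<close>
  moreover have "2 * C * n \<le> n\<^sup>2"
  proof -
    have "C ^ 1 \<le> C ^ 3" using C by (intro power_increasing) auto
    then have "2 * C \<le> n" "0 \<le> n" using n C by auto
    then show ?thesis using mult_right_mono[of "2 * C" n n] by (simp add: power2_eq_square)
  qed
  ultimately have incid: "n\<^sup>2 / 2 \<le> (\<Sum>P\<in>H1. real (card (N P)))" by simp
  have nondeg: "u P * w P \<noteq> (v P)\<^sup>2" if "P \<in> H1" for P using on_S that S(3) by blast
  obtain T \<alpha> \<beta> \<gamma> where T: "T \<subseteq> H1" "(\<alpha>, \<beta>, \<gamma>) \<noteq> (0, 0, 0)"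
    "\<And>P. P \<in> T \<Longrightarrow> \<alpha> * u P + \<beta> * v P + \<gamma> * w P = 0" "128 * C * n \<le> s ^ 6 * card T"
    by (rule coaxial_involutions[OF C n s H1 X nondeg inj incid[unfolded N_def]]) auto
  have "collinear T"
    using T(3) by (intro collinear_projective_line[OF indep[OF T(2)]])
      (simp add: uvw_defs inner_add_left)
  then show ?thesis using that T(1,4) by blast
qed

theorem theorem5p2:
  fixes C :: real
  assumes "C > 1"
  shows "\<exists>c::real. c > 0 \<and>
    (\<forall>(n::nat) (H1 :: (real^2) set) (H2 :: (real^2) set).
       n \<ge> 1 \<longrightarrow>
       finite H1 \<longrightarrow> finite H2 \<longrightarrow>
       n \<le> card H1 \<longrightarrow> real (card H1) \<le> C * real n \<longrightarrow>
       n \<le> card H2 \<longrightarrow> real (card H2) \<le> C * real n \<longrightarrow>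
       (\<exists>S. nondegenerate_conic S \<and> H2 \<subseteq> S \<and> S \<inter> H1 = {}) \<longrightarrow>
       n\<^sup>2 \<le> card (triple_lines H1 H2) \<longrightarrow>
       (\<exists>T. T \<subseteq> H1 \<and> real (card T) \<ge> c * real n \<and> collinear T))"
proof -
  define s where "s = nat \<lceil>512 * C ^ 4\<rceil>"
  have s: "s \<ge> 512 * C ^ 4" unfolding s_def by (rule real_nat_ceiling_ge)
  have s0: "real s > 0" using s assms by (smt (verit) zero_less_power)
  \<comment> \<open>The first term serves large \<open>n\<close>. The second makes
    \<open>c * n\<close> less than 1 when \<open>n < 512 C^3\<close>, where a single point
    suffices.\<close>
  define c where "c = min (128 * C / s ^ 6) (1 / (512 * C ^ 3))"
  show ?thesis
  proof (intro exI[of _ c] conjI allI impI)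
    show "c > 0" using assms s0 by (simp add: c_def)
    fix n :: nat and H1 H2 :: "(real^2) set"
    assume n1: "n \<ge> 1" and H: "finite H1" "finite H2"
      and H1: "n \<le> card H1" "real (card H1) \<le> C * real n"
      and H2: "n \<le> card H2" "real (card H2) \<le> C * real n"
      and "\<exists>S. nondegenerate_conic S \<and> H2 \<subseteq> S \<and> S \<inter> H1 = {}"
      and lines: "n\<^sup>2 \<le> card (triple_lines H1 H2)"
    then obtain S where S: "nondegenerate_conic S" "H2 \<subseteq> S" "S \<inter> H1 = {}" by blast
    show "\<exists>T. T \<subseteq> H1 \<and> real (card T) \<ge> c * real n \<and> collinear T"
    proof (cases "real n \<ge> 512 * C ^ 3")
      case True
      have "(real n)\<^sup>2 \<le> card (triple_lines H1 H2)"
        using lines by (metis of_nat_le_iff of_nat_power)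
      then obtain T where T: "T \<subseteq> H1" "collinear T" "128 * C * n \<le> s ^ 6 * card T"
        using many_collinear_of_triple_lines[OF assms True s H(1) H1(2) H(2) H2(2) S] by blast
      have "c * n \<le> 128 * C / s ^ 6 * n" unfolding c_def by (intro mult_right_mono) auto
      also have "\<dots> \<le> card T" using T(3) s0 by (simp add: field_simps)
      finally show ?thesis using T by blast
    next
      case False
      obtain P where P: "P \<in> H1" using n1 H1(1) by fastforce
      have "c * n \<le> 1 / (512 * C ^ 3) * n" unfolding c_def by (intro mult_right_mono) auto
      also have "\<dots> \<le> card {P}" using False assms by (simp add: field_simps)
      finally show ?thesis using P by (intro exI[of _ "{P}"]) auto
    qed
  qed
qed

end
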